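(* Let $\mathbb{F}$ be a field and let $A, B \subseteq \mathbb{F}^n$ be linear codes, both with trivial hull (i.e. $A\cap A^\perp=\{0\}$ and $B\cap B^\perp=\{0\}$, orthogonality taken with respect to the Euclidean inner product $\langle x,y\rangle=\sum_i x_iy_i$). For a code $U$ with trivial hull and any generator matrix $G_U$ of $U$, let $\Sigma_U = G_U^T (G_U G_U^T)^{-1} G_U$ (an $n\times n$ symmetric matrix independent of the choice of $G_U$), and let $\mathcal{G}_U$ be the weighted undirected graph on vertex set $\{1,\dots,n\}$ with adjacency matrix $\Sigma_U$. Then for every $n\times n$ permutation matrix $X$: $B = AX := \{aX : a \in A\}$ if and only if $\Sigma_B = X^T \Sigma_A X$, i.e. if and only if $X$ defines an isomorphism of weighted graphs from $\mathcal{G}_A$ to $\mathcal{G}_B$. In particular $A$ and $B$ are permutation equivalent if and only if $\mathcal{G}_A$ and $\mathcal{G}_B$ are isomorphic as weighted graphs.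
   Context: A linear code of length $n$ over $\mathbb{F}$ is a linear subspace of $\mathbb{F}^n$; a generator matrix is a matrix whose rows form a basis. Two codes $A,B$ are permutation equivalent if $B=AX$ for some permutation matrix $X$. A weighted graph on $\{1,\dots,n\}$ with weights in $\mathbb{F}$ is encoded by its adjacency matrix (entry $(i,j)$ is the weight of edge $(i,j)$, or $0$ if there is no edge); two such graphs with adjacency matrices $M_1,M_2$ are isomorphic via the permutation matrix $X$ when $M_2 = X^T M_1 X$. *)

theory Defs
  imports
    "Jordan_Normal_Form.VS_Connect"
    "Jordan_Normal_Form.Gauss_Jordan_Elimination"
begin

text \<open>Words of length \<open>n\<close> are the elements of \<open>carrier_vec n\<close>; positions and vertices
  \<open>1, \<dots>, n\<close> are represented by \<open>0, \<dots>, n - 1\<close>.\<close>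

definition linear_code :: "nat \<Rightarrow> 'a::field vec set \<Rightarrow> bool" where
  "linear_code n U \<longleftrightarrow> VectorSpace.subspace class_ring U (module_vec TYPE('a) n)"

definition dual_code :: "nat \<Rightarrow> 'a::field vec set \<Rightarrow> 'a vec set" where
  "dual_code n U = {x \<in> carrier_vec n. \<forall>y \<in> U. x \<bullet> y = 0}"

definition trivial_hull :: "nat \<Rightarrow> 'a::field vec set \<Rightarrow> bool" where
  "trivial_hull n U \<longleftrightarrow> U \<inter> dual_code n U = {0\<^sub>v n}"

text \<open>The row list must be distinct, since \<open>set\<close> forgets repeated rows. The zero code has the
  \<open>0 \<times> n\<close> matrix as its generator matrix.\<close>

definition generator_matrix :: "nat \<Rightarrow> 'a::field vec set \<Rightarrow> 'a mat \<Rightarrow> bool" where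
  "generator_matrix n U G \<longleftrightarrow>
     dim_col G = n \<and> distinct (rows G) \<and>
     vectorspace.basis class_ring (module_vec TYPE('a) n \<lparr>carrier := U\<rparr>) (set (rows G))"

text \<open>\<open>mat_inverse\<close> returns \<open>None\<close> on singular matrices, so \<open>sigma_mat G\<close> is meaningful only
  when \<open>G * G\<^sup>T\<close> is invertible.\<close>

definition sigma_mat :: "'a::field mat \<Rightarrow> 'a mat" where
  "sigma_mat G = G\<^sup>T * the (mat_inverse (G * G\<^sup>T)) * G"

definition Sigma_code :: "nat \<Rightarrow> 'a::field vec set \<Rightarrow> 'a mat" where
  "Sigma_code n U = sigma_mat (SOME G. generator_matrix n U G)"

definition permutation_matrix :: "nat \<Rightarrow> 'a::field mat \<Rightarrow> bool" where
  "permutation_matrix n X \<longleftrightarrow>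
     (\<exists>p. p permutes {0..<n} \<and> X = mat n n (\<lambda>(i, j). if j = p i then 1 else 0))"

text \<open>The product \<open>a X\<close> of a row vector with a matrix is \<open>X\<^sup>T *\<^sub>v a\<close>.\<close>

definition code_mult :: "'a::field vec set \<Rightarrow> 'a mat \<Rightarrow> 'a vec set" where
  "code_mult A X = {X\<^sup>T *\<^sub>v a | a. a \<in> A}"

definition permutation_equivalent :: "nat \<Rightarrow> 'a::field vec set \<Rightarrow> 'a vec set \<Rightarrow> bool" where
  "permutation_equivalent n A B \<longleftrightarrow> (\<exists>X. permutation_matrix n X \<and> B = code_mult A X)"

text \<open>A weighted undirected graph on \<open>n\<close> vertices is encoded by its adjacency matrix. Loops,
  i.e. nonzero diagonal entries, are allowed.\<close>

definition weighted_graph :: "nat \<Rightarrow> 'a::field mat \<Rightarrow> bool" where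
  "weighted_graph n M \<longleftrightarrow> M \<in> carrier_mat n n \<and> M\<^sup>T = M"

definition graph_iso_via :: "nat \<Rightarrow> 'a::field mat \<Rightarrow> 'a mat \<Rightarrow> 'a mat \<Rightarrow> bool" where
  "graph_iso_via n X M1 M2 \<longleftrightarrow> permutation_matrix n X \<and> M2 = X\<^sup>T * M1 * X"

definition graph_isomorphic :: "nat \<Rightarrow> 'a::field mat \<Rightarrow> 'a mat \<Rightarrow> bool" where
  "graph_isomorphic n M1 M2 \<longleftrightarrow> (\<exists>X. graph_iso_via n X M1 M2)"

definition code_graph :: "nat \<Rightarrow> 'a::field vec set \<Rightarrow> 'a mat" where
  "code_graph n U = Sigma_code n U"

end

theory Submission
  imports Defs "Jordan_Normal_Form.DL_Rank"
begin

text \<open>The matrix \<open>\<Sigma>\<^sub>U\<close> is the orthogonal projection onto \<open>U\<close>. A symmetric matrix that fixes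
  \<open>U\<close> pointwise and maps every word into \<open>U\<close> is unique, and it determines \<open>U\<close> as the set of its
  fixed points. For a permutation matrix \<open>X\<close>, which is orthogonal, \<open>X\<^sup>T \<Sigma>\<^sub>A X\<close> has these
  properties for the code \<open>AX\<close>; this yields both implications.\<close>

section \<open>Orthogonal projections as symmetric matrices\<close>

definition orth_proj :: "nat \<Rightarrow> 'a::field vec set \<Rightarrow> 'a mat \<Rightarrow> bool" where
  "orth_proj n U S \<longleftrightarrow> S \<in> carrier_mat n n \<and> S\<^sup>T = S \<and>
     (\<forall>v \<in> carrier_vec n. S *\<^sub>v v \<in> U) \<and> (\<forall>u \<in> U. S *\<^sub>v u = u)"

lemma eq_mat_if_mult_vec_eq:
  fixes S T :: "'a::field mat"
  assumes "S \<in> carrier_mat m n" "T \<in> carrier_mat m n"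
    and "\<And>v. v \<in> carrier_vec n \<Longrightarrow> S *\<^sub>v v = T *\<^sub>v v"
  shows "S = T"
proof (rule eq_matI)
  fix i j assume "i < dim_row T" "j < dim_col T"
  then have ij: "i < m" "j < n" using assms(2) by auto
  have "M $$ (i, j) = (M *\<^sub>v unit_vec n j) $ i" if "M \<in> carrier_mat m n" for M :: "'a mat"
    using that ij by simp
  then show "S $$ (i, j) = T $$ (i, j)"
    using assms(1,2) assms(3)[of "unit_vec n j"] by simp
qed (use assms(1,2) in auto)

text \<open>Each matrix fixes the values of the other, since these lie in \<open>U\<close>; hence
  \<open>S * T = T\<close> and \<open>T * S = S\<close>. Transposing the second equation, by
  symmetry, gives \<open>S * T = S\<close>.\<close>

lemma orth_proj_unique:
  assumes S: "orth_proj n U S" and T: "orth_proj n U T"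
  shows "S = T"
proof -
  have c: "S \<in> carrier_mat n n" "T \<in> carrier_mat n n" "S\<^sup>T = S" "T\<^sup>T = T"
    using S T by (auto simp: orth_proj_def)
  have "P * Q = Q" if "orth_proj n U P" "orth_proj n U Q" for P Q
    by (rule eq_mat_if_mult_vec_eq[of _ n n])
      (use that in \<open>auto simp: orth_proj_def\<close>)
  then have "S * T = T" and TS: "T * S = S" using S T by blast+
  have "S = (T * S)\<^sup>T" using TS c by simp
  also have "\<dots> = S * T" using c by (simp add: transpose_mult)
  also have "\<dots> = T" by fact
  finally show ?thesis .
qed

text \<open>A fixed vector is a value of \<open>S\<close> and therefore lies in \<open>U\<close>.
  This is how a code is recovered from its matrix.\<close>

lemma orth_proj_fixed_points:
  assumes "orth_proj n U S" "U \<subseteq> carrier_vec n"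
  shows "U = {v \<in> carrier_vec n. S *\<^sub>v v = v}"
proof (intro subset_antisym subsetI)
  fix v assume "v \<in> U"
  then show "v \<in> {v \<in> carrier_vec n. S *\<^sub>v v = v}"
    using assms by (auto simp: orth_proj_def)
next
  fix v assume "v \<in> {v \<in> carrier_vec n. S *\<^sub>v v = v}"
  then have v: "v \<in> carrier_vec n" "S *\<^sub>v v = v" by simp_all
  then have "S *\<^sub>v v \<in> U" using assms(1) unfolding orth_proj_def by blast
  then show "v \<in> U" unfolding v(2) .
qed

section \<open>Generator matrices and their Gram matrices\<close>

lemma linear_code_subset: "linear_code n U \<Longrightarrow> U \<subseteq> carrier_vec n"
  unfolding linear_code_def subspace_def submodule_def by (auto simp: module_vec_simps)

text \<open>Independent subsets of \<open>U\<close> have at most as many elements as the dimension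
  of the ambient space, so a maximal one exists and is a basis. Listing it without repetition gives
  the rows.\<close>

lemma generator_matrix_exists:
  fixes U :: "'a::field vec set"
  assumes "linear_code n U"
  shows "\<exists>G. generator_matrix n U G"
proof -
  interpret V: vec_space "TYPE('a)" n .
  have sub: "submodule class_ring U (module_vec TYPE('a) n)"
    using assms by (simp add: linear_code_def subspace_def)
  have Uc: "U \<subseteq> carrier_vec n" by (rule linear_code_subset[OF assms])
  interpret W: vectorspace class_ring "module_vec TYPE('a) n \<lparr>carrier := U\<rparr>"
    using assms unfolding linear_code_def by (rule V.subspace_is_vs)
  \<comment> \<open>Independence inside \<open>U\<close> agrees with independence in the ambient
    space, which has finite dimension.\<close>
  have bound: "finite A \<and> card A \<le> V.dim" if "A \<subseteq> U \<and> W.lin_indpt A" for A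
    using that V.li_le_dim[OF V.fin_dim, of A] V.span_li_not_depend(2)[OF _ sub, of A] Uc by auto
  have "{} \<subseteq> U \<and> W.lin_indpt {}" by (auto simp: W.lin_dep_def)
  from maximal_exists[of "\<lambda>A. A \<subseteq> U \<and> W.lin_indpt A", OF bound this]
  obtain A where A: "finite A" "maximal A (\<lambda>A. A \<subseteq> U \<and> W.lin_indpt A)" by blast
  have basis: "W.basis A" by (rule W.max_li_is_basis) (use A in simp)
  obtain bs where bs: "set bs = A" "distinct bs" using finite_distinct_list[OF A(1)] by blast
  have "set bs \<subseteq> carrier_vec n" using A(2) bs(1) Uc by (auto simp: maximal_def)
  then have "rows (mat_of_rows n bs) = bs" by (rule rows_mat_of_rows)
  then have "generator_matrix n U (mat_of_rows n bs)"
    using basis bs unfolding generator_matrix_def by simp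
  then show ?thesis ..
qed

text \<open>Turns the basis property into matrix form: spanning says that \<open>G\<^sup>T\<close>
  has range \<open>U\<close>, and independence says that \<open>G\<^sup>T\<close> has trivial
  kernel. The latter relies on distinct rows, as a repeated row would be invisible in
  \<open>set (rows G)\<close>.\<close>

lemma generator_matrix_range:
  fixes U :: "'a::field vec set"
  assumes U: "linear_code n U" and G: "generator_matrix n U G"
  shows "U = {G\<^sup>T *\<^sub>v c | c. c \<in> carrier_vec (dim_row G)}"
    and "\<And>c. c \<in> carrier_vec (dim_row G) \<Longrightarrow> G\<^sup>T *\<^sub>v c = 0\<^sub>v n \<Longrightarrow> c = 0\<^sub>v (dim_row G)"
proof -
  interpret V: vec_space "TYPE('a)" n .
  have sub: "submodule class_ring U (module_vec TYPE('a) n)"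
    using U by (simp add: linear_code_def subspace_def)
  interpret W: vectorspace class_ring "module_vec TYPE('a) n \<lparr>carrier := U\<rparr>"
    using U unfolding linear_code_def by (rule V.subspace_is_vs)
  define k where "k = dim_row G"
  have Gc: "G \<in> carrier_mat k n" and d: "distinct (rows G)"
    and basis: "W.basis (set (rows G))"
    using G unfolding generator_matrix_def k_def by auto
  have rows: "set (rows G) \<subseteq> U" "W.lin_indpt (set (rows G))" "W.span (set (rows G)) = U"
    using basis unfolding W.basis_def by auto
  have "V.row_space G = U"
    using rows(3) V.span_li_not_depend(1)[OF rows(1) sub] by (simp add: V.row_space_def)
  moreover have "V.row_space G = {G\<^sup>T *\<^sub>v c | c. c \<in> carrier_vec k}"
    unfolding V.row_space_eq[OF Gc] using Gc by auto
  ultimately show "U = {G\<^sup>T *\<^sub>v c | c. c \<in> carrier_vec (dim_row G)}" by (simp add: k_def)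
  have "V.lin_indpt (set (cols G\<^sup>T))"
    using rows(2) V.span_li_not_depend(2)[OF rows(1) sub] by simp
  then have "c = 0\<^sub>v k" if "c \<in> carrier_vec k" "G\<^sup>T *\<^sub>v c = 0\<^sub>v n" for c
    using V.lin_depI[of "G\<^sup>T" k c] that d Gc by auto
  then show "c = 0\<^sub>v (dim_row G)"
    if "c \<in> carrier_vec (dim_row G)" "G\<^sup>T *\<^sub>v c = 0\<^sub>v n" for c
    using that by (simp add: k_def)
qed

text \<open>A nonzero \<open>c\<close> in the kernel of \<open>G * G\<^sup>T\<close> would give a
  word \<open>x = G\<^sup>T *\<^sub>v c\<close> of \<open>U\<close> with
  \<open>G *\<^sub>v x = 0\<close>, that is, orthogonal to all of \<open>U\<close>. The trivial hull
  forces \<open>x = 0\<close>, contradicting the injectivity of \<open>G\<^sup>T\<close>.\<close>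

lemma gram_matrix_det_nonzero:
  fixes U :: "'a::field vec set"
  assumes U: "linear_code n U" and hull: "trivial_hull n U" and G: "generator_matrix n U G"
  shows "det (G * G\<^sup>T) \<noteq> 0"
proof
  define k where "k = dim_row G"
  have Gc: "G \<in> carrier_mat k n" using G unfolding generator_matrix_def k_def by auto
  note range = generator_matrix_range[OF U G, folded k_def]
  assume "det (G * G\<^sup>T) = 0"
  then obtain c where c: "c \<in> carrier_vec k" "c \<noteq> 0\<^sub>v k" "G * G\<^sup>T *\<^sub>v c = 0\<^sub>v k"
    using det_0_iff_vec_prod_zero_field[of "G * G\<^sup>T" k] Gc by auto
  define x where "x = G\<^sup>T *\<^sub>v c"
  have x: "x \<in> carrier_vec n" "x \<in> U" unfolding x_def using Gc c(1) range(1) by auto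
  have Gx: "G *\<^sub>v x = 0\<^sub>v k" using c Gc unfolding x_def by auto
  have "x \<bullet> y = 0" if "y \<in> U" for y
  proof -
    obtain b where b: "b \<in> carrier_vec k" "y = G\<^sup>T *\<^sub>v b" using \<open>y \<in> U\<close> range(1) by auto
    have "y \<bullet> x = b \<bullet> (G *\<^sub>v x)"
      unfolding b(2) using transpose_vec_mult_scalar[OF Gc x(1) b(1)] .
    also have "\<dots> = 0" using b(1) Gx by simp
    finally show ?thesis using comm_scalar_prod[of x n y] x(1) b Gc by simp
  qed
  then have "x \<in> U \<inter> dual_code n U" using x by (auto simp: dual_code_def)
  then have "x = 0\<^sub>v n" using hull by (auto simp: trivial_hull_def)
  then show False using range(2)[OF c(1)] c(2) by (simp add: x_def)
qed

lemma mat_inverse_if_det_nonzero: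
  fixes M :: "'a::field mat"
  assumes M: "M \<in> carrier_mat k k" and "det M \<noteq> 0"
  obtains N where "mat_inverse M = Some N" "M * N = 1\<^sub>m k" "N * M = 1\<^sub>m k" "N \<in> carrier_mat k k"
proof (cases "mat_inverse M")
  case None
  then show ?thesis
    \<comment> \<open>The argument \<open>()\<close> fixes the free extension slot of the matrix
      ring record, so that both facts speak of the same ring.\<close>
    using mat_inverse(1)[OF M, of "()"] det_non_zero_imp_unit[OF assms, of "()"] by simp
next
  case (Some N)
  then show ?thesis using mat_inverse(2)[OF M Some] that by simp
qed

text \<open>With \<open>N\<close> the inverse of \<open>G * G\<^sup>T\<close>, every value of
  \<open>G\<^sup>T * N * G\<close> lies in the range of \<open>G\<^sup>T\<close>, which is
  \<open>U\<close>. On a codeword \<open>G\<^sup>T *\<^sub>v c\<close> the factor \<open>N\<close>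
  cancels the Gram matrix and returns \<open>c\<close>.\<close>

lemma generator_matrix_orth_proj:
  fixes U :: "'a::field vec set"
  assumes U: "linear_code n U" and hull: "trivial_hull n U" and G: "generator_matrix n U G"
  shows "invertible_mat (G * G\<^sup>T)" and "orth_proj n U (sigma_mat G)"
proof -
  define k where "k = dim_row G"
  have Gc: "G \<in> carrier_mat k n" using G unfolding generator_matrix_def k_def by auto
  note range = generator_matrix_range(1)[OF U G, folded k_def]
  define M where "M = G * G\<^sup>T"
  have Mc: "M \<in> carrier_mat k k" and Msym: "M\<^sup>T = M"
    using Gc by (auto simp: M_def transpose_mult[OF Gc])
  obtain N where N: "mat_inverse M = Some N" "M * N = 1\<^sub>m k" "N * M = 1\<^sub>m k" "N \<in> carrier_mat k k"
    using mat_inverse_if_det_nonzero[OF Mc] gram_matrix_det_nonzero[OF assms] M_def by metis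
  show "invertible_mat (G * G\<^sup>T)"
    using N Mc unfolding M_def[symmetric] invertible_mat_def inverts_mat_def by auto
  \<comment> \<open>The inverse of a symmetric matrix is symmetric: regrouping turns
    \<open>N\<^sup>T * M\<close> into \<open>(M * N)\<^sup>T\<close>, the identity.\<close>
  have "N\<^sup>T = N\<^sup>T * (M * N)" using N by simp
  also have "\<dots> = (M * N)\<^sup>T * N"
    unfolding transpose_mult[OF Mc N(4)] Msym
    by (rule assoc_mult_mat[symmetric]) (use N(4) Mc in auto)
  also have "\<dots> = N" using N by simp
  finally have Nsym: "N\<^sup>T = N" .
  define S where "S = G\<^sup>T * N * G"
  have Sigma: "sigma_mat G = S" unfolding sigma_mat_def S_def M_def[symmetric] N(1) by simp
  have Sc: "S \<in> carrier_mat n n" using Gc N(4) by (auto simp: S_def)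
  have "S\<^sup>T = G\<^sup>T * (G\<^sup>T * N)\<^sup>T" unfolding S_def by (rule transpose_mult) (use Gc N(4) in auto)
  also have "(G\<^sup>T * N)\<^sup>T = N * G" using transpose_mult[of "G\<^sup>T" n k N k] Gc N(4) Nsym by simp
  also have "G\<^sup>T * (N * G) = S" unfolding S_def using Gc N(4) by simp
  finally have Ssym: "S\<^sup>T = S" .
  have Sv: "S *\<^sub>v v = G\<^sup>T *\<^sub>v (N *\<^sub>v (G *\<^sub>v v))" if "v \<in> carrier_vec n" for v
    unfolding S_def using that Gc N(4)
    by (simp add: assoc_mult_mat_vec[of _ n k _ n] assoc_mult_mat_vec[of _ n k _ k])
  have into: "S *\<^sub>v v \<in> U" if "v \<in> carrier_vec n" for v
    using range Sv[OF that] N(4) that Gc by auto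
  have fixed: "S *\<^sub>v u = u" if "u \<in> U" for u
  proof -
    obtain c where c: "c \<in> carrier_vec k" "u = G\<^sup>T *\<^sub>v c" using \<open>u \<in> U\<close> range by auto
    have "N *\<^sub>v (G *\<^sub>v u) = N *\<^sub>v (M *\<^sub>v c)" unfolding M_def c(2) using c(1) Gc by simp
    also have "\<dots> = (N * M) *\<^sub>v c" using c(1) N(4) Mc by simp
    also have "\<dots> = c" using c(1) N(3) by simp
    finally show ?thesis using Sv[of u] c Gc by simp
  qed
  show "orth_proj n U (sigma_mat G)"
    unfolding orth_proj_def Sigma using Sc Ssym into fixed by blast
qed

text \<open>Existence of a generator matrix ensures that the choice in \<open>Sigma_code\<close>
  picks a genuine one.\<close>

lemma orth_proj_Sigma_code:
  assumes "linear_code n U" "trivial_hull n U"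
  shows "orth_proj n U (Sigma_code n U)"
  unfolding Sigma_code_def
  by (rule generator_matrix_orth_proj(2)[OF assms someI_ex[OF generator_matrix_exists[OF assms(1)]]])

section \<open>Action of permutation matrices\<close>

lemma permutation_matrix_orthogonal:
  fixes X :: "'a::field mat"
  assumes "permutation_matrix n X"
  shows "X \<in> carrier_mat n n" "X * X\<^sup>T = 1\<^sub>m n"
proof -
  obtain p where p: "p permutes {0..<n}" and X: "X = mat n n (\<lambda>(i, j). if j = p i then 1 else 0)"
    using assms by (auto simp: permutation_matrix_def)
  show Xc: "X \<in> carrier_mat n n" by (simp add: X)
  show "X * X\<^sup>T = 1\<^sub>m n"
  proof (rule eq_matI)
    fix i k assume "i < dim_row (1\<^sub>m n :: 'a mat)" "k < dim_col (1\<^sub>m n :: 'a mat)"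
    then have ik: "i < n" "k < n" by auto
    have pi: "p i \<in> {0..<n}" using p ik permutes_in_image[OF p] by auto
    have "(X * X\<^sup>T) $$ (i, k) = (\<Sum>j = 0..<n. X $$ (i, j) * X $$ (k, j))"
      using ik Xc by (simp add: scalar_prod_def)
    \<comment> \<open>Row \<open>i\<close> of \<open>X\<close> is nonzero only in column
      \<open>p i\<close>, so a single summand can survive; injectivity of \<open>p\<close> then
      compares the two rows.\<close>
    also have "\<dots> = (\<Sum>j = 0..<n. if j = p i then (if p i = p k then 1 else 0) else 0)"
      by (rule sum.cong) (use ik X in auto)
    also have "\<dots> = (if p i = p k then 1 else 0)" using pi by simp
    also have "\<dots> = 1\<^sub>m n $$ (i, k)" using ik permutes_inj[OF p] by (auto dest: injD)
    finally show "(X * X\<^sup>T) $$ (i, k) = 1\<^sub>m n $$ (i, k)" .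
  qed (use Xc in auto)
qed

text \<open>For \<open>u = X\<^sup>T *\<^sub>v a\<close> with \<open>a\<close> in \<open>A\<close>,
  orthogonality gives \<open>X *\<^sub>v u = a\<close>, which \<open>S\<close> fixes and
  \<open>X\<^sup>T\<close> sends back to \<open>u\<close>. Values of the conjugate are images under
  \<open>X\<^sup>T\<close> of values of \<open>S\<close>, hence lie in
  \<open>code_mult A X\<close>.\<close>

lemma orth_proj_code_mult:
  fixes X :: "'a::field mat"
  assumes S: "orth_proj n A S" and A: "A \<subseteq> carrier_vec n"
    and X: "X \<in> carrier_mat n n" "X * X\<^sup>T = 1\<^sub>m n"
  shows "orth_proj n (code_mult A X) (X\<^sup>T * S * X)"
proof -
  have Sc: "S \<in> carrier_mat n n" and Ssym: "S\<^sup>T = S" using S by (auto simp: orth_proj_def)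
  have "(X\<^sup>T * S * X)\<^sup>T = X\<^sup>T * (X\<^sup>T * S)\<^sup>T" by (rule transpose_mult) (use X Sc in auto)
  also have "(X\<^sup>T * S)\<^sup>T = S * X" using transpose_mult[of "X\<^sup>T" n n S n] X Sc Ssym by simp
  finally have sym: "(X\<^sup>T * S * X)\<^sup>T = X\<^sup>T * S * X" using X Sc by simp
  have app: "X\<^sup>T * S * X *\<^sub>v v = X\<^sup>T *\<^sub>v (S *\<^sub>v (X *\<^sub>v v))" if "v \<in> carrier_vec n" for v
    using that X(1) Sc by (simp add: assoc_mult_mat_vec[of _ n n _ n])
  have into: "X\<^sup>T * S * X *\<^sub>v v \<in> code_mult A X" if "v \<in> carrier_vec n" for v
  proof -
    have "S *\<^sub>v (X *\<^sub>v v) \<in> A" using S that X(1) by (simp add: orth_proj_def)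
    then show ?thesis unfolding app[OF that] code_mult_def by blast
  qed
  have fixed: "X\<^sup>T * S * X *\<^sub>v u = u" if "u \<in> code_mult A X" for u
  proof -
    obtain a where a: "a \<in> A" "u = X\<^sup>T *\<^sub>v a" using \<open>u \<in> code_mult A X\<close> by (auto simp: code_mult_def)
    have ac: "a \<in> carrier_vec n" using a(1) A by auto
    have "X *\<^sub>v u = X * X\<^sup>T *\<^sub>v a" unfolding a(2) using X(1) ac by simp
    then have "X *\<^sub>v u = a" using ac X(2) by simp
    then show ?thesis using app[of u] a ac X(1) S by (simp add: orth_proj_def)
  qed
  show ?thesis unfolding orth_proj_def using X(1) Sc sym into fixed by auto
qed

text \<open>If the codes agree, both matrices project onto the same code and uniqueness applies. If
  the matrices agree, so do their sets of fixed points.\<close>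

lemma code_mult_eq_iff_Sigma_code:
  fixes A B :: "'a::field vec set"
  assumes A: "linear_code n A" "trivial_hull n A" and B: "linear_code n B" "trivial_hull n B"
    and "permutation_matrix n X"
  shows "B = code_mult A X \<longleftrightarrow> Sigma_code n B = X\<^sup>T * Sigma_code n A * X"
proof -
  note X = permutation_matrix_orthogonal[OF \<open>permutation_matrix n X\<close>]
  note Ac = linear_code_subset[OF A(1)]
  have P: "orth_proj n (code_mult A X) (X\<^sup>T * Sigma_code n A * X)"
    by (rule orth_proj_code_mult[OF orth_proj_Sigma_code[OF A] Ac X])
  have "code_mult A X \<subseteq> carrier_vec n" using Ac X(1) by (auto simp: code_mult_def)
  note fixed = orth_proj_fixed_points[OF orth_proj_Sigma_code[OF B] linear_code_subset[OF B(1)]]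
    orth_proj_fixed_points[OF P this]
  show ?thesis
  proof
    assume "B = code_mult A X"
    then show "Sigma_code n B = X\<^sup>T * Sigma_code n A * X"
      using orth_proj_unique[OF orth_proj_Sigma_code[OF B]] P by blast
  next
    assume "Sigma_code n B = X\<^sup>T * Sigma_code n A * X"
    \<comment> \<open>\<open>fixed(1)\<close> has \<open>B\<close> on both sides and would loop
      under unfolding; it is substituted once.\<close>
    then show "B = code_mult A X" unfolding fixed(2) by (subst fixed(1)) simp
  qed
qed

text \<open>Independence of the generator matrix is uniqueness of the projection: every
  \<open>sigma_mat G\<close> projects onto \<open>U\<close>.\<close>

lemma code_graph_well_defined:
  fixes U :: "'a::field vec set"
  assumes "linear_code n U" "trivial_hull n U"
  shows "(\<exists>G. generator_matrix n U G) \<and>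
    (\<forall>G. generator_matrix n U G \<longrightarrow> invertible_mat (G * G\<^sup>T) \<and> Sigma_code n U = sigma_mat G) \<and>
    weighted_graph n (code_graph n U)"
proof (intro conjI allI impI)
  show "\<exists>G. generator_matrix n U G" by (rule generator_matrix_exists[OF assms(1)])
  show "weighted_graph n (code_graph n U)"
    using orth_proj_Sigma_code[OF assms]
    by (simp add: weighted_graph_def code_graph_def orth_proj_def)
  fix G assume G: "generator_matrix n U G"
  show "invertible_mat (G * G\<^sup>T)" by (rule generator_matrix_orth_proj(1)[OF assms G])
  show "Sigma_code n U = sigma_mat G"
    by (rule orth_proj_unique[OF orth_proj_Sigma_code[OF assms]
          generator_matrix_orth_proj(2)[OF assms G]])
qed

theorem theorem1:
  fixes n :: nat and A B :: "'a::field vec set"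
  assumes "linear_code n A" and "linear_code n B"
    and "trivial_hull n A" and "trivial_hull n B"
  shows "(\<forall>U \<in> {A, B}.
            (\<exists>G. generator_matrix n U G) \<and>
            (\<forall>G. generator_matrix n U G \<longrightarrow>
                 invertible_mat (G * G\<^sup>T) \<and> Sigma_code n U = sigma_mat G) \<and>
            weighted_graph n (code_graph n U)) \<and>
         (\<forall>X. permutation_matrix n X \<longrightarrow>
            (B = code_mult A X \<longleftrightarrow> Sigma_code n B = X\<^sup>T * Sigma_code n A * X) \<and>
            (B = code_mult A X \<longleftrightarrow> graph_iso_via n X (code_graph n A) (code_graph n B))) \<and>
         (permutation_equivalent n A B \<longleftrightarrow>
            graph_isomorphic n (code_graph n A) (code_graph n B))"
proof -
  have wd: "\<forall>U \<in> {A, B}.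
      (\<exists>G. generator_matrix n U G) \<and>
      (\<forall>G. generator_matrix n U G \<longrightarrow>
           invertible_mat (G * G\<^sup>T) \<and> Sigma_code n U = sigma_mat G) \<and>
      weighted_graph n (code_graph n U)"
    using code_graph_well_defined assms by blast
  have iff: "B = code_mult A X \<longleftrightarrow> Sigma_code n B = X\<^sup>T * Sigma_code n A * X"
    if "permutation_matrix n X" for X
    using code_mult_eq_iff_Sigma_code[OF assms(1,3,2,4) that] .
  then have iso: "B = code_mult A X \<longleftrightarrow> graph_iso_via n X (code_graph n A) (code_graph n B)"
    if "permutation_matrix n X" for X
    using that by (simp add: graph_iso_via_def code_graph_def)
  \<comment> \<open>The same \<open>X\<close> serves as witness on both sides, because
    \<open>graph_iso_via\<close> includes that \<open>X\<close> is a permutation matrix.\<close>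
  then have "permutation_equivalent n A B \<longleftrightarrow>
      graph_isomorphic n (code_graph n A) (code_graph n B)"
    unfolding permutation_equivalent_def graph_isomorphic_def
    by (auto simp: graph_iso_via_def)
  with wd iff iso show ?thesis by blast
qed

end
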